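(* Let $\alpha\in(0,1)$, let $\psi\in\mathrm{Hol}(\mathbb{D})$ and let $\varphi$ be a holomorphic self-map of $\mathbb{D}$. (i) If $C_{\psi,\varphi}$ is bounded on $\mathcal{D}_{\alpha}$ then $$\sup_{z \in \mathbb{D}}|\psi(z)|\left(\frac{1-|z|^2}{1-|\varphi(z)|^2}\right)^{\frac{\alpha}{2}}<\infty.$$ (ii) If $C_{\psi,\varphi}$ is compact on $\mathcal{D}_{\alpha}$ then $$\lim_{|z|\to 1^-}|\psi(z)|\left(\frac{1-|z|^2}{1-|\varphi(z)|^2}\right)^{\frac{\alpha}{2}}=0.$$
   Context: $\mathbb{D}=\{z\in\mathbb{C}:|z|<1\}$ and $\mathrm{Hol}(\mathbb{D})$ is the space of complex-valued holomorphic functions on $\mathbb{D}$. A holomorphic self-map of $\mathbb{D}$ is $\varphi\in\mathrm{Hol}(\mathbb{D})$ with $\varphi(\mathbb{D})\subseteq\mathbb{D}$. For $\psi\in\mathrm{Hol}(\mathbb{D})$ and a holomorphic self-map $\varphi$, the weighted composition operator is $C_{\psi,\varphi}f=\psi\,(f\circ\varphi)$ for $f\in\mathrm{Hol}(\mathbb{D})$. For $\alpha\in\mathbb{R}$, the weighted Dirichlet space $\mathcal{D}_\alpha$ is the Hilbert space of all $f(z)=\sum_{n\ge 0}a_nz^n\in\mathrm{Hol}(\mathbb{D})$ with $\|f\|_{\mathcal{D}_\alpha}^2=\sum_{n\ge 0}(n+1)^{1-\alpha}|a_n|^2<\infty$, with inner product $\langle f,g\rangle_{\mathcal{D}_\alpha}=\sum_{n\ge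 0}(n+1)^{1-\alpha}a_n\overline{b_n}$ for $g(z)=\sum_{n\ge0} b_nz^n$. "$C_{\psi,\varphi}$ is bounded (compact) on $\mathcal{D}_\alpha$" means that it maps $\mathcal{D}_\alpha$ into itself and is a bounded (compact) linear operator there. *)

theory Defs
  imports "HOL-Complex_Analysis.Complex_Analysis"
begin

abbreviation unit_disc :: "complex set" where
  "unit_disc \<equiv> ball 0 1"

definition holomorphic_self_map :: "(complex \<Rightarrow> complex) \<Rightarrow> bool" where
  "holomorphic_self_map \<phi> \<longleftrightarrow> \<phi> holomorphic_on unit_disc \<and> \<phi> ` unit_disc \<subseteq> unit_disc"

definition weighted_comp ::
    "(complex \<Rightarrow> complex) \<Rightarrow> (complex \<Rightarrow> complex) \<Rightarrow> (complex \<Rightarrow> complex) \<Rightarrow> complex \<Rightarrow> complex" where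
  "weighted_comp \<psi> \<phi> f = (\<lambda>z. \<psi> z * f (\<phi> z))"

(* Functions on the disc are represented by total functions on the complex plane whose values
   outside the disc are irrelevant: fps_expansion f 0 is the Taylor series of f at 0, so that
   everything below depends only on the restriction of f to the disc, and functions agreeing
   on the disc are to be thought of as the same element. *)

definition dirichlet_term :: "real \<Rightarrow> (complex \<Rightarrow> complex) \<Rightarrow> nat \<Rightarrow> real" where
  "dirichlet_term \<alpha> f n = real (n + 1) powr (1 - \<alpha>) * (cmod (fps_nth (fps_expansion f 0) n))\<^sup>2"

definition dirichlet_space :: "real \<Rightarrow> (complex \<Rightarrow> complex) set" where
  "dirichlet_space \<alpha> = {f. f holomorphic_on unit_disc \<and> summable (dirichlet_term \<alpha> f)}"

definition dirichlet_norm :: "real \<Rightarrow> (complex \<Rightarrow> complex) \<Rightarrow> real" where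
  "dirichlet_norm \<alpha> f = sqrt (\<Sum>n. dirichlet_term \<alpha> f n)"

definition linear_on_dirichlet ::
    "real \<Rightarrow> ((complex \<Rightarrow> complex) \<Rightarrow> (complex \<Rightarrow> complex)) \<Rightarrow> bool" where
  "linear_on_dirichlet \<alpha> T \<longleftrightarrow>
     T ` dirichlet_space \<alpha> \<subseteq> dirichlet_space \<alpha> \<and>
     (\<forall>f\<in>dirichlet_space \<alpha>. \<forall>g\<in>dirichlet_space \<alpha>. \<forall>a b. \<forall>z\<in>unit_disc.
        T (\<lambda>w. a * f w + b * g w) z = a * T f z + b * T g z)"

definition bounded_on_dirichlet ::
    "real \<Rightarrow> ((complex \<Rightarrow> complex) \<Rightarrow> (complex \<Rightarrow> complex)) \<Rightarrow> bool" where
  "bounded_on_dirichlet \<alpha> T \<longleftrightarrow> linear_on_dirichlet \<alpha> T \<and>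
     (\<exists>K. \<forall>f\<in>dirichlet_space \<alpha>. dirichlet_norm \<alpha> (T f) \<le> K * dirichlet_norm \<alpha> f)"

(* Compactness in its sequential form: the image of every norm-bounded sequence has a
   subsequence converging in norm to an element of the space. *)

definition compact_on_dirichlet ::
    "real \<Rightarrow> ((complex \<Rightarrow> complex) \<Rightarrow> (complex \<Rightarrow> complex)) \<Rightarrow> bool" where
  "compact_on_dirichlet \<alpha> T \<longleftrightarrow> linear_on_dirichlet \<alpha> T \<and>
     (\<forall>f :: nat \<Rightarrow> complex \<Rightarrow> complex.
        range f \<subseteq> dirichlet_space \<alpha> \<and> bdd_above (range (\<lambda>n. dirichlet_norm \<alpha> (f n))) \<longrightarrow>
        (\<exists>g\<in>dirichlet_space \<alpha>. \<exists>r :: nat \<Rightarrow> nat. strict_mono r \<and>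
           (\<lambda>n. dirichlet_norm \<alpha> (\<lambda>z. T (f (r n)) z - g z)) \<longlonglongrightarrow> 0))"

end

theory Submission
  imports Defs
begin

text \<open>
  The weighted Dirichlet space has the reproducing kernel
  k_w(z) = \<Sum>n. (n + 1) powr (\<alpha> - 1) * (cnj w * z) ^ n, so that the square of the norm of k_w
  is K(\<bar>w\<bar>^2) with K(x) = \<Sum>n. (n + 1) powr (\<alpha> - 1) * x ^ n. Two facts drive the proof.

  First, K(x) is comparable to (1 - x) powr (-\<alpha>), because the coefficients of K are comparable to
  the binomial coefficients of that power (lemmas \<open>kernel_diagonal_ge\<close> and
  \<open>kernel_diagonal_le\<close>). Hence the quantity in the theorem is, up to a constant factor,
  \<bar>\<psi>(z)\<bar> * sqrt (K(\<bar>\<phi>(z)\<bar>^2) / K(\<bar>z\<bar>^2)). With the unit vector u = k_w / \<parallel>k_w\<parallel> for w = \<phi>(z), for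
  which u(w) = sqrt (K(\<bar>w\<bar>^2)), this is the value of \<bar>(C u)(z)\<bar> / sqrt (K(\<bar>z\<bar>^2)), where C is the
  weighted composition operator (lemma \<open>weighted_distortion_le_test_value\<close>).

  Second, the Cauchy-Schwarz inequality bounds \<bar>f(z)\<bar> / sqrt (K(\<bar>z\<bar>^2)) by \<parallel>f\<parallel>; applied to C u it
  gives the claim about bounded operators. For a fixed f this quotient even tends to 0 as
  \<bar>z\<bar> \<rightarrow> 1 (lemma \<open>dirichlet_little_o_at_unit_circle\<close>), since f is a polynomial plus a
  remainder of small norm and K blows up at 1.

  For a compact operator, suppose that the quantity stays away from 0 along points z_n with
  \<bar>z_n\<bar> \<rightarrow> 1, and let u_n be the corresponding unit vectors. A subsequence of C u_n converges in
  norm to some g, so \<bar>(C u_n)(z_n)\<bar> / sqrt (K(\<bar>z_n\<bar>^2)) is at most \<parallel>C u_n - g\<parallel> plus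
  \<bar>g(z_n)\<bar> / sqrt (K(\<bar>z_n\<bar>^2)) along it, and both terms tend to 0: a contradiction. This argument
  treats alike the points z_n whose images \<phi>(z_n) approach the unit circle and those whose images
  stay in a compact subset of the disc.
\<close>

section \<open>The diagonal of the reproducing kernel\<close>

text \<open>
  With k_w the reproducing kernel at w, this is K in k_w(w) = K(\<bar>w\<bar>^2).
\<close>

definition kernel_diagonal :: "real \<Rightarrow> real \<Rightarrow> real" where
  "kernel_diagonal \<alpha> x = (\<Sum>n. real (n + 1) powr (\<alpha> - 1) * x ^ n)"

text \<open>Bernoulli's inequality for exponents in [0, 1], that is, concavity of x \<mapsto> x powr p.\<close>

lemma powr_le_affine:
  fixes x p :: real
  assumes "0 < x" "0 \<le> p" "p \<le> 1"
  shows "x powr p \<le> 1 + p * (x - 1)"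
  using Youngs_inequality_0[of p "1 - p" x 1] assms by (simp add: algebra_simps)

lemma pochhammer_ratio_Suc:
  fixes \<alpha> :: real
  shows "pochhammer \<alpha> (Suc n) / fact (Suc n) =
         pochhammer \<alpha> n / fact n * ((real n + \<alpha>) / (real n + 1))"
  by (simp add: pochhammer_rec' field_simps)

text \<open>
  The left-hand side is the modulus of the binomial coefficient \<open>-\<alpha> gchoose n\<close>. Its product with
  (n + 1) powr (1 - \<alpha>) decreases in n from its value 1 at n = 0: by Bernoulli's inequality,
  one step with q = n + 1 multiplies it by at most
  (1 - (1 - \<alpha>) / q) * (1 + (1 - \<alpha>) / q) \<le> 1.
\<close>

lemma binomial_coefficient_le_powr:
  fixes \<alpha> :: real
  assumes "0 < \<alpha>" "\<alpha> < 1"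
  shows "pochhammer \<alpha> n / fact n \<le> real (n + 1) powr (\<alpha> - 1)"
proof (induction n)
  case (Suc n)
  define q where "q = real n + 1"
  have q: "q > 0" by (simp add: q_def)
  have neg_power: "t powr (\<alpha> - 1) = inverse (t powr (1 - \<alpha>))" for t :: real
    using powr_minus[of t "1 - \<alpha>"] by simp
  have "((q + 1) / q) powr (1 - \<alpha>) \<le> 1 + (1 - \<alpha>) * ((q + 1) / q - 1)"
    using assms q by (intro powr_le_affine) auto
  also have "\<dots> = 1 + (1 - \<alpha>) / q"
    using q by (simp add: field_simps)
  finally have "(1 - (1 - \<alpha>) / q) * ((q + 1) / q) powr (1 - \<alpha>) \<le>
      (1 - (1 - \<alpha>) / q) * (1 + (1 - \<alpha>) / q)"
    using assms q by (intro mult_left_mono) (auto simp: q_def field_simps)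
  also have "\<dots> = 1 - ((1 - \<alpha>) / q)\<^sup>2"
    by (simp add: algebra_simps power2_eq_square)
  also have "\<dots> \<le> 1" by simp
  also have "1 - (1 - \<alpha>) / q = (real n + \<alpha>) / q"
    using q by (simp add: q_def field_simps)
  finally have "(real n + \<alpha>) / q * ((q + 1) powr (1 - \<alpha>) / q powr (1 - \<alpha>)) \<le> 1"
    using q by (simp add: powr_divide)
  hence "q powr (\<alpha> - 1) * ((real n + \<alpha>) / q) \<le> (q + 1) powr (\<alpha> - 1)"
    using q unfolding neg_power by (simp add: field_simps)
  moreover have "pochhammer \<alpha> n / fact n * ((real n + \<alpha>) / q) \<le>
      q powr (\<alpha> - 1) * ((real n + \<alpha>) / q)"
    using Suc assms q by (intro mult_right_mono) (auto simp: q_def add.commute)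
  ultimately show ?case
    unfolding pochhammer_ratio_Suc by (simp add: q_def algebra_simps)
qed simp

text \<open>
  With the weight n powr (1 - \<alpha>) in place of (n + 1) powr (1 - \<alpha>), the product increases in n from
  its value \<alpha> at n = 1. The induction therefore runs on the unshifted weight, and
  (n + 1) powr (\<alpha> - 1) \<le> n powr (\<alpha> - 1) finishes the proof.
\<close>

lemma powr_le_binomial_coefficient:
  fixes \<alpha> :: real
  assumes "0 < \<alpha>" "\<alpha> < 1"
  shows "\<alpha> * real (n + 1) powr (\<alpha> - 1) \<le> pochhammer \<alpha> n / fact n"
proof (cases n)
  case (Suc m)
  have "\<alpha> * real (Suc m) powr (\<alpha> - 1) \<le> pochhammer \<alpha> (Suc m) / fact (Suc m)"
  proof (induction m)
    case (Suc m)
    define q where "q = real m + 1"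
    have q: "q > 0" by (simp add: q_def)
    have neg_power: "t powr (\<alpha> - 1) = inverse (t powr (1 - \<alpha>))" for t :: real
      using powr_minus[of t "1 - \<alpha>"] by simp
    have "(q / (q + 1)) powr (1 - \<alpha>) \<le> 1 + (1 - \<alpha>) * (q / (q + 1) - 1)"
      using assms q by (intro powr_le_affine) auto
    also have "\<dots> = (q + \<alpha>) / (q + 1)"
      using q by (simp add: field_simps)
    finally have *: "q powr (1 - \<alpha>) / (q + 1) powr (1 - \<alpha>) \<le> (q + \<alpha>) / (q + 1)"
      using q by (simp add: powr_divide)
    have "(q + 1) powr (\<alpha> - 1) =
        q powr (\<alpha> - 1) * (q powr (1 - \<alpha>) / (q + 1) powr (1 - \<alpha>))"
      using q unfolding neg_power by (simp add: divide_inverse)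
    also have "\<dots> \<le> q powr (\<alpha> - 1) * ((q + \<alpha>) / (q + 1))"
      by (intro mult_left_mono *) auto
    finally have "(q + 1) powr (\<alpha> - 1) \<le> q powr (\<alpha> - 1) * ((q + \<alpha>) / (q + 1))" .
    hence "\<alpha> * (q + 1) powr (\<alpha> - 1) \<le> \<alpha> * q powr (\<alpha> - 1) * ((q + \<alpha>) / (q + 1))"
      using assms by (simp add: mult.assoc mult_left_mono del: times_divide_eq_right)
    also have "\<dots> \<le> pochhammer \<alpha> (Suc m) / fact (Suc m) * ((q + \<alpha>) / (q + 1))"
      using Suc assms q by (intro mult_right_mono) (auto simp: q_def add.commute)
    finally show ?case
      unfolding pochhammer_ratio_Suc[of \<alpha> "Suc m"] by (simp add: q_def algebra_simps)
  qed simp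
  moreover have "\<alpha> * real (n + 1) powr (\<alpha> - 1) \<le> \<alpha> * real n powr (\<alpha> - 1)"
    using assms Suc by (intro mult_left_mono powr_mono2') auto
  ultimately show ?thesis
    using Suc by simp
qed (use assms in simp)

lemma binomial_series_negative_exponent:
  fixes \<alpha> x :: real
  assumes "0 \<le> x" "x < 1"
  shows "(\<lambda>n. pochhammer \<alpha> n / fact n * x ^ n) sums (1 - x) powr (-\<alpha>)"
proof -
  have "(-\<alpha> gchoose n) * (-x) ^ n = pochhammer \<alpha> n / fact n * x ^ n" for n
    unfolding power_minus[of x n] by (simp add: gbinomial_pochhammer)
  thus ?thesis
    using gen_binomial_real[of "-x" "-\<alpha>"] assms by simp
qed

lemma summable_kernel_diagonal:
  assumes "\<alpha> < 1" "0 \<le> x" "x < (1::real)"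
  shows "summable (\<lambda>n. real (n + 1) powr (\<alpha> - 1) * x ^ n)"
proof (rule summable_comparison_test)
  have "real (n + 1) powr (\<alpha> - 1) \<le> 1" for n
    using assms powr_mono[of "\<alpha> - 1" 0 "real (n + 1)"] by simp
  thus "\<exists>N. \<forall>n\<ge>N. norm (real (n + 1) powr (\<alpha> - 1) * x ^ n) \<le> x ^ n"
    using assms by (auto intro!: mult_left_le_one_le)
  show "summable (\<lambda>n. x ^ n)" using assms by simp
qed

lemma kernel_diagonal_ge:
  assumes "0 < \<alpha>" "\<alpha> < 1" "0 \<le> x" "x < 1"
  shows "(1 - x) powr (-\<alpha>) \<le> kernel_diagonal \<alpha> x"
proof -
  have "pochhammer \<alpha> n / fact n * x ^ n \<le> real (n + 1) powr (\<alpha> - 1) * x ^ n" for n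
    using binomial_coefficient_le_powr[of \<alpha> n] assms by (intro mult_right_mono) auto
  thus ?thesis
    using binomial_series_negative_exponent[of x \<alpha>] summable_kernel_diagonal[of \<alpha> x] assms
    unfolding kernel_diagonal_def by (intro sums_le[OF _ _ summable_sums]) auto
qed

lemma kernel_diagonal_le:
  assumes "0 < \<alpha>" "\<alpha> < 1" "0 \<le> x" "x < 1"
  shows "\<alpha> * kernel_diagonal \<alpha> x \<le> (1 - x) powr (-\<alpha>)"
proof -
  have "\<alpha> * (real (n + 1) powr (\<alpha> - 1) * x ^ n) \<le> pochhammer \<alpha> n / fact n * x ^ n" for n
    unfolding mult.assoc[symmetric]
    using powr_le_binomial_coefficient[of \<alpha> n] assms by (intro mult_right_mono) auto
  moreover have "(\<lambda>n. \<alpha> * (real (n + 1) powr (\<alpha> - 1) * x ^ n)) sums (\<alpha> * kernel_diagonal \<alpha> x)"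
    unfolding kernel_diagonal_def
    using assms by (intro sums_mult summable_sums summable_kernel_diagonal) auto
  ultimately show ?thesis
    using binomial_series_negative_exponent[OF assms(3,4)] by (rule sums_le)
qed

lemma kernel_diagonal_pos:
  assumes "0 < \<alpha>" "\<alpha> < 1" "0 \<le> x" "x < 1"
  shows "kernel_diagonal \<alpha> x > 0"
  using kernel_diagonal_ge[OF assms] assms
  by (smt (verit) powr_gt_zero)

section \<open>Pointwise bounds for functions in the weighted Dirichlet space\<close>

lemma cmod_sq_less_1: "z \<in> unit_disc \<Longrightarrow> (cmod z)\<^sup>2 < 1"
  by (simp add: power_less_one_iff)

lemma dirichlet_term_nonneg: "0 \<le> dirichlet_term \<alpha> f n"
  by (simp add: dirichlet_term_def)

lemma taylor_series_sums:
  assumes "f holomorphic_on unit_disc" "z \<in> unit_disc"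
  shows "(\<lambda>n. fps_nth (fps_expansion f 0) n * z ^ n) sums f z"
  using holomorphic_power_series[OF assms] by (simp add: fps_expansion_def)

text \<open>
  The first N Taylor terms are estimated trivially on the disc, and the others by the
  Cauchy-Schwarz inequality after splitting the weight (n + 1) powr (1 - \<alpha>) evenly between the
  Taylor coefficients and the powers of z. Taking N = 0 gives the norm bound for point
  evaluations; a large N makes the second summand small relative to the kernel.
\<close>

lemma dirichlet_pointwise_tail_bound:
  assumes "f \<in> dirichlet_space \<alpha>" "\<alpha> < 1" "z \<in> unit_disc"
  shows "cmod (f z) \<le> (\<Sum>n<N. cmod (fps_nth (fps_expansion f 0) n)) +
           sqrt (\<Sum>n. dirichlet_term \<alpha> f (n + N)) * sqrt (kernel_diagonal \<alpha> ((cmod z)\<^sup>2))"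
proof -
  define a where "a = fps_nth (fps_expansion f 0)"
  define u where "u n = real (n + 1) powr ((1 - \<alpha>) / 2) * cmod (a n)" for n
  define v where "v n = real (n + 1) powr ((\<alpha> - 1) / 2) * cmod z ^ n" for n
  have z1: "cmod z < 1" using assms by simp
  have uv: "u n * v n = cmod (a n * z ^ n)" for n
  proof -
    have "real (n + 1) powr ((1 - \<alpha>) / 2) * real (n + 1) powr ((\<alpha> - 1) / 2) = 1"
      by (simp flip: powr_add add_divide_distrib)
    thus ?thesis
      by (simp add: u_def v_def norm_mult norm_power algebra_simps)
  qed
  have u2: "(u n)\<^sup>2 = dirichlet_term \<alpha> f n" for n
    by (simp add: u_def dirichlet_term_def a_def power_mult_distrib powr_power diff_divide_distrib)
  have v2: "(v n)\<^sup>2 = real (n + 1) powr (\<alpha> - 1) * ((cmod z)\<^sup>2) ^ n" for n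
    by (simp add: v_def power_mult_distrib powr_power diff_divide_distrib mult.commute flip: power_mult)
  have summ_u: "summable (\<lambda>n. (u n)\<^sup>2)"
    using assms by (simp add: u2 dirichlet_space_def)
  have summ_v: "summable (\<lambda>n. (v n)\<^sup>2)"
    unfolding v2 using assms cmod_sq_less_1[of z] by (intro summable_kernel_diagonal) auto
  have CS: "(\<Sum>n=N..<M. u n * v n) \<le>
      sqrt (\<Sum>n. (u (n + N))\<^sup>2) * sqrt (kernel_diagonal \<alpha> ((cmod z)\<^sup>2))" if "N \<le> M" for M
  proof -
    have "(\<Sum>n=N..<M. (u n)\<^sup>2) = (\<Sum>n<M - N. (u (n + N))\<^sup>2)"
      using sum.shift_bounds_nat_ivl[of "\<lambda>n. (u n)\<^sup>2" 0 N "M - N"] that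
      by (simp add: atLeast0LessThan)
    also have "\<dots> \<le> (\<Sum>n. (u (n + N))\<^sup>2)"
      using summ_u by (intro sum_le_suminf summable_ignore_initial_segment) auto
    finally have U: "(\<Sum>n=N..<M. (u n)\<^sup>2) \<le> (\<Sum>n. (u (n + N))\<^sup>2)" .
    have V: "(\<Sum>n=N..<M. (v n)\<^sup>2) \<le> kernel_diagonal \<alpha> ((cmod z)\<^sup>2)"
      unfolding kernel_diagonal_def v2[symmetric]
      by (intro sum_le_suminf summ_v) auto
    have "(\<Sum>n=N..<M. u n * v n)\<^sup>2 \<le> (\<Sum>n=N..<M. (u n)\<^sup>2) * (\<Sum>n=N..<M. (v n)\<^sup>2)"
      by (rule Cauchy_Schwarz_ineq_sum)
    also have "\<dots> \<le> (\<Sum>n. (u (n + N))\<^sup>2) * kernel_diagonal \<alpha> ((cmod z)\<^sup>2)"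
    proof (intro mult_mono U V)
      show "0 \<le> (\<Sum>n. (u (n + N))\<^sup>2)"
        using U by (meson order_trans sum_nonneg zero_le_power2)
    qed (simp add: sum_nonneg)
    finally show ?thesis
      unfolding real_sqrt_mult[symmetric] by (rule real_le_rsqrt)
  qed
  have "(\<lambda>M. cmod (\<Sum>n<M. a n * z ^ n)) \<longlonglongrightarrow> cmod (f z)"
    using taylor_series_sums[of f z] assms
    unfolding sums_def a_def dirichlet_space_def by (intro tendsto_norm) auto
  moreover have "cmod (\<Sum>n<M. a n * z ^ n) \<le> (\<Sum>n<N. cmod (a n)) +
      sqrt (\<Sum>n. (u (n + N))\<^sup>2) * sqrt (kernel_diagonal \<alpha> ((cmod z)\<^sup>2))" if "N \<le> M" for M
  proof -
    have "cmod (\<Sum>n<M. a n * z ^ n) \<le> (\<Sum>n<M. cmod (a n * z ^ n))"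
      by (rule norm_sum)
    also have "\<dots> = (\<Sum>n<N. cmod (a n * z ^ n)) + (\<Sum>n=N..<M. u n * v n)"
      unfolding uv using that
      by (simp add: lessThan_atLeast0 sum.atLeastLessThan_concat)
    also have "(\<Sum>n<N. cmod (a n * z ^ n)) \<le> (\<Sum>n<N. cmod (a n))"
      using z1 by (intro sum_mono) (simp add: norm_mult norm_power mult_left_le power_le_one)
    finally show ?thesis using CS[OF that] by linarith
  qed
  ultimately show ?thesis
    unfolding u2 a_def by (intro LIMSEQ_le_const2) auto
qed

lemma dirichlet_pointwise_bound:
  assumes "f \<in> dirichlet_space \<alpha>" "\<alpha> < 1" "z \<in> unit_disc"
  shows "cmod (f z) \<le> dirichlet_norm \<alpha> f * sqrt (kernel_diagonal \<alpha> ((cmod z)\<^sup>2))"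
  using dirichlet_pointwise_tail_bound[OF assms, of 0] by (simp add: dirichlet_norm_def)

lemma eventually_near_unit_circle:
  "eventually (\<lambda>z. z \<in> unit_disc) (filtercomap cmod (at_left 1))"
proof -
  have "eventually (\<lambda>x::real. x < 1) (at_left 1)"
    by (simp add: eventually_at_filter)
  thus ?thesis
    by (auto simp: eventually_filtercomap)
qed

text \<open>
  The point evaluations have unbounded norms near the unit circle, as
  1 / K(x) \<le> (1 - x) powr \<alpha>, which tends to 0 for x \<rightarrow> 1 because \<alpha> is positive.
\<close>

lemma kernel_diagonal_at_unit_circle:
  assumes "0 < \<alpha>" "\<alpha> < 1"
  shows "((\<lambda>z. 1 / sqrt (kernel_diagonal \<alpha> ((cmod z)\<^sup>2))) \<longlongrightarrow> 0) (filtercomap cmod (at_left 1))"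
proof (rule real_tendsto_sandwich)
  let ?F = "filtercomap cmod (at_left 1)"
  show "eventually (\<lambda>z. 0 \<le> 1 / sqrt (kernel_diagonal \<alpha> ((cmod z)\<^sup>2))) ?F"
    using eventually_near_unit_circle
  proof eventually_elim
    case (elim z)
    thus ?case
      using kernel_diagonal_pos[of \<alpha> "(cmod z)\<^sup>2"] cmod_sq_less_1[of z] assms by simp
  qed
  show "eventually (\<lambda>z. 1 / sqrt (kernel_diagonal \<alpha> ((cmod z)\<^sup>2)) \<le>
      sqrt ((1 - (cmod z)\<^sup>2) powr \<alpha>)) ?F"
    using eventually_near_unit_circle
  proof eventually_elim
    case (elim z)
    have x: "(cmod z)\<^sup>2 < 1" using elim by (rule cmod_sq_less_1)
    have "1 / kernel_diagonal \<alpha> ((cmod z)\<^sup>2) \<le> (1 - (cmod z)\<^sup>2) powr \<alpha>"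
      using kernel_diagonal_ge[of \<alpha> "(cmod z)\<^sup>2"] kernel_diagonal_pos[of \<alpha> "(cmod z)\<^sup>2"] x assms
      by (simp add: powr_minus field_simps)
    hence "sqrt (1 / kernel_diagonal \<alpha> ((cmod z)\<^sup>2)) \<le> sqrt ((1 - (cmod z)\<^sup>2) powr \<alpha>)"
      by simp
    thus ?case by (simp add: real_sqrt_divide)
  qed
  have cmod: "filterlim cmod (at_left 1) ?F"
    by (rule filterlim_filtercomap)
  have "((\<lambda>r::real. sqrt ((1 - r\<^sup>2) powr \<alpha>)) \<longlongrightarrow> sqrt ((1 - 1\<^sup>2) powr \<alpha>)) (at_left 1)"
  proof (intro tendsto_intros tendsto_powr')
    have "eventually (\<lambda>r::real. 0 < r \<and> r < 1) (at_left 1)"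
      by (rule eventually_at_leftI[of 0]) auto
    thus "1 - 1\<^sup>2 \<noteq> (0::real) \<or> 0 < \<alpha> \<and> (\<forall>\<^sub>F r in at_left (1::real). 0 \<le> 1 - r\<^sup>2)"
      using assms by (auto elim!: eventually_mono simp: power_le_one)
  qed
  from filterlim_compose[OF this cmod]
  show "((\<lambda>z. sqrt ((1 - (cmod z)\<^sup>2) powr \<alpha>)) \<longlongrightarrow> 0) ?F"
    by simp
qed simp

text \<open>
  A single function grows strictly slower than the norm of point evaluation: the initial Taylor
  segment is bounded while the kernel blows up, and the remaining Taylor coefficients have small
  norm.
\<close>

lemma dirichlet_little_o_at_unit_circle:
  assumes "f \<in> dirichlet_space \<alpha>" "0 < \<alpha>" "\<alpha> < 1"
  shows "((\<lambda>z. cmod (f z) / sqrt (kernel_diagonal \<alpha> ((cmod z)\<^sup>2))) \<longlongrightarrow> 0)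
           (filtercomap cmod (at_left 1))"
proof (rule tendstoI)
  let ?F = "filtercomap cmod (at_left 1)"
  fix e :: real assume e: "e > 0"
  have summ: "summable (dirichlet_term \<alpha> f)"
    using assms by (simp add: dirichlet_space_def)
  obtain N where N: "\<And>n. n \<ge> N \<Longrightarrow> norm (\<Sum>i. dirichlet_term \<alpha> f (i + n)) < (e / 2)\<^sup>2"
    using suminf_exist_split[OF _ summ, of "(e / 2)\<^sup>2"] e by auto
  have "sqrt (\<Sum>i. dirichlet_term \<alpha> f (i + N)) < sqrt ((e / 2)\<^sup>2)"
    using N[of N] by (subst real_sqrt_less_iff) auto
  hence tail: "sqrt (\<Sum>i. dirichlet_term \<alpha> f (i + N)) < e / 2"
    using e by simp
  define S where "S = (\<Sum>n<N. cmod (fps_nth (fps_expansion f 0) n))"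
  have "((\<lambda>z. S * (1 / sqrt (kernel_diagonal \<alpha> ((cmod z)\<^sup>2)))) \<longlongrightarrow> S * 0) ?F"
    using assms by (intro tendsto_mult tendsto_const kernel_diagonal_at_unit_circle)
  hence "eventually (\<lambda>z. S * (1 / sqrt (kernel_diagonal \<alpha> ((cmod z)\<^sup>2))) < e / 2) ?F"
    using e by (intro order_tendstoD) auto
  thus "eventually (\<lambda>z. dist (cmod (f z) / sqrt (kernel_diagonal \<alpha> ((cmod z)\<^sup>2))) 0 < e) ?F"
    using eventually_near_unit_circle
  proof eventually_elim
    case (elim z)
    let ?s = "sqrt (kernel_diagonal \<alpha> ((cmod z)\<^sup>2))"
    have s: "?s > 0"
      using kernel_diagonal_pos[of \<alpha> "(cmod z)\<^sup>2"] cmod_sq_less_1[of z] elim assms by simp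
    have "cmod (f z) / ?s \<le> (S + sqrt (\<Sum>n. dirichlet_term \<alpha> f (n + N)) * ?s) / ?s"
      using dirichlet_pointwise_tail_bound[of f \<alpha> z N] elim assms s
      unfolding S_def by (intro divide_right_mono) auto
    also have "\<dots> = S * (1 / ?s) + sqrt (\<Sum>n. dirichlet_term \<alpha> f (n + N))"
      using s by (simp add: field_simps)
    also have "\<dots> < e"
      using elim(1) tail by linarith
    finally show ?case using s by simp
  qed
qed

lemma dirichlet_space_diff:
  assumes "f \<in> dirichlet_space \<alpha>" "g \<in> dirichlet_space \<alpha>"
  shows "(\<lambda>z. f z - g z) \<in> dirichlet_space \<alpha>"
proof -
  let ?a = "\<lambda>f. fps_nth (fps_expansion f 0)"
  have hol: "f holomorphic_on unit_disc" "g holomorphic_on unit_disc"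
    using assms by (auto simp: dirichlet_space_def)
  have "f has_fps_expansion fps_expansion f 0" "g has_fps_expansion fps_expansion g 0"
    using hol by (auto intro!: has_fps_expansion_fps_expansion[of unit_disc])
  hence coeff: "?a (\<lambda>z. f z - g z) n = ?a f n - ?a g n" for n
    using fps_expansion_eqI[OF has_fps_expansion_diff, of f _ g] by simp
  have "dirichlet_term \<alpha> (\<lambda>z. f z - g z) n \<le>
      2 * dirichlet_term \<alpha> f n + 2 * dirichlet_term \<alpha> g n" for n
  proof -
    \<comment> \<open>Expanding 0 \<le> (s - t)^2 gives (s + t)^2 \<le> 2 s^2 + 2 t^2.\<close>
    have "(cmod (?a f n - ?a g n))\<^sup>2 \<le> (cmod (?a f n) + cmod (?a g n))\<^sup>2"
      by (intro power_mono norm_triangle_ineq4) auto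
    also have "\<dots> \<le> 2 * (cmod (?a f n))\<^sup>2 + 2 * (cmod (?a g n))\<^sup>2"
      using zero_le_power2[of "cmod (?a f n) - cmod (?a g n)"]
      by (simp add: power2_sum power2_diff)
    finally have "real (n + 1) powr (1 - \<alpha>) * (cmod (?a f n - ?a g n))\<^sup>2 \<le>
        real (n + 1) powr (1 - \<alpha>) * (2 * (cmod (?a f n))\<^sup>2 + 2 * (cmod (?a g n))\<^sup>2)"
      by (intro mult_left_mono) auto
    thus ?thesis
      by (simp add: dirichlet_term_def coeff algebra_simps)
  qed
  note bound = this
  have "summable (\<lambda>n. 2 * dirichlet_term \<alpha> f n + 2 * dirichlet_term \<alpha> g n)"
    using assms by (intro summable_add summable_mult) (auto simp: dirichlet_space_def)
  hence "summable (dirichlet_term \<alpha> (\<lambda>z. f z - g z))"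
    by (rule summable_comparison_test'[where N = 0])
       (use bound in \<open>simp add: dirichlet_term_nonneg\<close>)
  thus ?thesis
    using hol by (auto simp: dirichlet_space_def intro!: holomorphic_intros)
qed

section \<open>Normalized reproducing kernels\<close>

text \<open>
  This is k_w divided by its norm. The normalizing constant sits inside the coefficients so that
  the defining series is literally the Taylor series at 0.
\<close>

definition normalized_kernel :: "real \<Rightarrow> complex \<Rightarrow> complex \<Rightarrow> complex" where
  "normalized_kernel \<alpha> w z =
     (\<Sum>n. of_real (real (n + 1) powr (\<alpha> - 1) / sqrt (kernel_diagonal \<alpha> ((cmod w)\<^sup>2))) *
            cnj w ^ n * z ^ n)"

lemma normalized_kernel_sums:
  assumes "0 < \<alpha>" "\<alpha> < 1" "w \<in> unit_disc" "z \<in> unit_disc"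
  shows "(\<lambda>n. of_real (real (n + 1) powr (\<alpha> - 1) / sqrt (kernel_diagonal \<alpha> ((cmod w)\<^sup>2))) *
            cnj w ^ n * z ^ n) sums normalized_kernel \<alpha> w z"
  unfolding normalized_kernel_def
proof (rule summable_sums[OF summable_norm_cancel])
  let ?K = "kernel_diagonal \<alpha> ((cmod w)\<^sup>2)"
  have K: "?K > 0"
    using assms cmod_sq_less_1[of w] by (intro kernel_diagonal_pos) auto
  have "cmod w * cmod z < 1 * 1"
    using assms by (intro mult_strict_mono') auto
  hence "summable (\<lambda>n. real (n + 1) powr (\<alpha> - 1) * (cmod w * cmod z) ^ n / sqrt ?K)"
    using assms by (intro summable_divide summable_kernel_diagonal) auto
  thus "summable (\<lambda>n. cmod (of_real (real (n + 1) powr (\<alpha> - 1) / sqrt ?K) * cnj w ^ n * z ^ n))"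
    using K unfolding norm_mult norm_of_real norm_power complex_mod_cnj
    by (simp add: power_mult_distrib mult_ac)
qed

lemma normalized_kernel_holomorphic:
  assumes "0 < \<alpha>" "\<alpha> < 1" "w \<in> unit_disc"
  shows "normalized_kernel \<alpha> w holomorphic_on unit_disc"
  by (rule power_series_holomorphic) (use normalized_kernel_sums[OF assms] in \<open>simp only: diff_zero\<close>)

lemma normalized_kernel_coefficient:
  assumes "0 < \<alpha>" "\<alpha> < 1" "w \<in> unit_disc"
  shows "fps_nth (fps_expansion (normalized_kernel \<alpha> w) 0) n =
    of_real (real (n + 1) powr (\<alpha> - 1) / sqrt (kernel_diagonal \<alpha> ((cmod w)\<^sup>2))) * cnj w ^ n"
proof -
  let ?c = "\<lambda>n. of_real (real (n + 1) powr (\<alpha> - 1) / sqrt (kernel_diagonal \<alpha> ((cmod w)\<^sup>2))) *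
    cnj w ^ n"
  have "eventually (\<lambda>z::complex. z \<in> unit_disc) (nhds 0)"
    by (intro eventually_nhds_in_open) auto
  hence "normalized_kernel \<alpha> w has_fps_expansion Abs_fps ?c"
    by (intro has_fps_expansionI, elim eventually_mono)
       (use normalized_kernel_sums[OF assms] in simp)
  thus ?thesis
    by (simp add: fps_expansion_eqI)
qed

lemma normalized_kernel_term_sums:
  assumes "0 < \<alpha>" "\<alpha> < 1" "w \<in> unit_disc"
  shows "dirichlet_term \<alpha> (normalized_kernel \<alpha> w) sums 1"
proof -
  let ?K = "kernel_diagonal \<alpha> ((cmod w)\<^sup>2)"
  have K: "?K > 0"
    using assms cmod_sq_less_1[of w] by (intro kernel_diagonal_pos) auto
  have "dirichlet_term \<alpha> (normalized_kernel \<alpha> w) n =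
      real (n + 1) powr (\<alpha> - 1) * ((cmod w)\<^sup>2) ^ n / ?K" for n
  proof -
    define p where "p = real (n + 1) powr (\<alpha> - 1)"
    have p: "real (n + 1) powr (1 - \<alpha>) = 1 / p" "p > 0"
      using powr_minus_divide[of "real (n + 1)" "\<alpha> - 1"] by (simp_all add: p_def)
    have "cmod (fps_nth (fps_expansion (normalized_kernel \<alpha> w) 0) n) = p / sqrt ?K * cmod w ^ n"
      unfolding normalized_kernel_coefficient[OF assms] norm_mult norm_of_real norm_power
      using K by (simp add: p_def)
    hence "dirichlet_term \<alpha> (normalized_kernel \<alpha> w) n = 1 / p * (p / sqrt ?K * cmod w ^ n)\<^sup>2"
      by (simp only: dirichlet_term_def p(1))
    also have "\<dots> = p * (cmod w ^ n)\<^sup>2 / ?K"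
      using K p(2) by (simp add: power_mult_distrib power_divide) (simp add: power2_eq_square)
    also have "(cmod w ^ n)\<^sup>2 = ((cmod w)\<^sup>2) ^ n"
      by (simp add: mult.commute flip: power_mult)
    finally show ?thesis by (simp only: p_def)
  qed
  moreover have "(\<lambda>n. real (n + 1) powr (\<alpha> - 1) * ((cmod w)\<^sup>2) ^ n / ?K) sums (?K / ?K)"
    unfolding kernel_diagonal_def[of \<alpha> "(cmod w)\<^sup>2"] using assms cmod_sq_less_1[of w]
    by (intro sums_divide summable_sums summable_kernel_diagonal) auto
  ultimately show ?thesis
    using K by (simp add: sums_def)
qed

lemma normalized_kernel_in_dirichlet_space:
  assumes "0 < \<alpha>" "\<alpha> < 1" "w \<in> unit_disc"
  shows "normalized_kernel \<alpha> w \<in> dirichlet_space \<alpha>"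
  using normalized_kernel_holomorphic[OF assms]
    sums_summable[OF normalized_kernel_term_sums[OF assms]]
  unfolding dirichlet_space_def by blast

lemma dirichlet_norm_normalized_kernel:
  assumes "0 < \<alpha>" "\<alpha> < 1" "w \<in> unit_disc"
  shows "dirichlet_norm \<alpha> (normalized_kernel \<alpha> w) = 1"
  unfolding dirichlet_norm_def sums_unique[OF normalized_kernel_term_sums[OF assms], symmetric]
  by simp

text \<open>
  The unit vector at w attains the bound of \<open>dirichlet_pointwise_bound\<close> at the point w, since
  K / sqrt K = sqrt K.
\<close>

lemma normalized_kernel_diagonal:
  assumes "0 < \<alpha>" "\<alpha> < 1" "w \<in> unit_disc"
  shows "normalized_kernel \<alpha> w w = of_real (sqrt (kernel_diagonal \<alpha> ((cmod w)\<^sup>2)))"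
proof -
  let ?K = "kernel_diagonal \<alpha> ((cmod w)\<^sup>2)"
  have K: "?K > 0"
    using assms cmod_sq_less_1[of w] by (intro kernel_diagonal_pos) auto
  have "(\<lambda>n. real (n + 1) powr (\<alpha> - 1) * ((cmod w)\<^sup>2) ^ n / sqrt ?K) sums (?K / sqrt ?K)"
    unfolding kernel_diagonal_def[of \<alpha> "(cmod w)\<^sup>2"] using assms cmod_sq_less_1[of w]
    by (intro sums_divide summable_sums summable_kernel_diagonal) auto
  hence "(\<lambda>n. complex_of_real (real (n + 1) powr (\<alpha> - 1) * ((cmod w)\<^sup>2) ^ n / sqrt ?K))
      sums of_real (?K / sqrt ?K)"
    by (rule sums_of_real)
  moreover have "complex_of_real (real (n + 1) powr (\<alpha> - 1) * ((cmod w)\<^sup>2) ^ n / sqrt ?K) =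
      of_real (real (n + 1) powr (\<alpha> - 1) / sqrt ?K) * cnj w ^ n * w ^ n" for n
  proof -
    have "complex_of_real (((cmod w)\<^sup>2) ^ n) = cnj w ^ n * w ^ n"
      unfolding of_real_power[of "(cmod w)\<^sup>2" n] complex_norm_square
      by (simp add: power_mult_distrib mult.commute)
    thus ?thesis
      by (simp only: of_real_mult of_real_divide times_divide_eq_left mult.assoc)
  qed
  ultimately have "(\<lambda>n. of_real (real (n + 1) powr (\<alpha> - 1) / sqrt ?K) * cnj w ^ n * w ^ n)
      sums complex_of_real (?K / sqrt ?K)"
    by (simp only:)
  from sums_unique2[OF normalized_kernel_sums[OF assms assms(3)] this]
  show ?thesis
    using K by (simp add: real_div_sqrt)
qed

text \<open>
  The upper estimate of the kernel is used at z and the lower one at \<phi>(z), which turns the quotient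
  of powers into K(\<bar>\<phi>(z)\<bar>^2) / (\<alpha> * K(\<bar>z\<bar>^2)). The square root of the numerator is the value at \<phi>(z)
  of the unit vector there.
\<close>

lemma weighted_distortion_le_test_value:
  fixes \<psi> \<phi> :: "complex \<Rightarrow> complex"
  assumes "0 < \<alpha>" "\<alpha> < 1" "z \<in> unit_disc" "\<phi> z \<in> unit_disc"
  shows "cmod (\<psi> z) * ((1 - (cmod z)\<^sup>2) / (1 - (cmod (\<phi> z))\<^sup>2)) powr (\<alpha> / 2) \<le>
    cmod (weighted_comp \<psi> \<phi> (normalized_kernel \<alpha> (\<phi> z)) z) /
      sqrt (kernel_diagonal \<alpha> ((cmod z)\<^sup>2)) / sqrt \<alpha>"
proof -
  define x where "x = (cmod z)\<^sup>2"
  define y where "y = (cmod (\<phi> z))\<^sup>2"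
  have x: "0 \<le> x" "x < 1" using assms cmod_sq_less_1[of z] by (auto simp: x_def)
  have y: "0 \<le> y" "y < 1" using assms cmod_sq_less_1[of "\<phi> z"] by (auto simp: y_def)
  have Kx: "kernel_diagonal \<alpha> x > 0" and Ky: "kernel_diagonal \<alpha> y > 0"
    using kernel_diagonal_pos assms x y by auto
  have "((1 - x) / (1 - y)) powr (\<alpha> / 2) = sqrt (((1 - x) / (1 - y)) powr \<alpha>)"
    using x y by (simp add: powr_powr flip: powr_half_sqrt)
  also have "((1 - x) / (1 - y)) powr \<alpha> = (1 - y) powr (-\<alpha>) / (1 - x) powr (-\<alpha>)"
    using x y by (simp add: powr_divide powr_minus field_simps)
  also have "\<dots> \<le> kernel_diagonal \<alpha> y / (\<alpha> * kernel_diagonal \<alpha> x)"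
    using kernel_diagonal_ge[of \<alpha> y] kernel_diagonal_le[of \<alpha> x] assms x y Kx Ky
    by (intro frac_le) auto
  finally have "((1 - x) / (1 - y)) powr (\<alpha> / 2) \<le>
      sqrt (kernel_diagonal \<alpha> y) / sqrt (kernel_diagonal \<alpha> x) / sqrt \<alpha>"
    by (simp add: real_sqrt_divide real_sqrt_mult mult.commute)
  hence "cmod (\<psi> z) * ((1 - x) / (1 - y)) powr (\<alpha> / 2) \<le>
      cmod (\<psi> z) * (sqrt (kernel_diagonal \<alpha> y) / sqrt (kernel_diagonal \<alpha> x) / sqrt \<alpha>)"
    by (intro mult_left_mono) auto
  also have "\<dots> = cmod (\<psi> z) * sqrt (kernel_diagonal \<alpha> y) / sqrt (kernel_diagonal \<alpha> x) / sqrt \<alpha>"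
    by simp
  also have "cmod (\<psi> z) * sqrt (kernel_diagonal \<alpha> y) =
      cmod (weighted_comp \<psi> \<phi> (normalized_kernel \<alpha> (\<phi> z)) z)"
    using normalized_kernel_diagonal[OF assms(1,2,4)] Ky
    by (simp add: weighted_comp_def norm_mult y_def)
  finally show ?thesis by (simp only: x_def y_def)
qed

section \<open>Necessity for boundedness and compactness\<close>

lemma bounded_imp_weighted_distortion_bounded:
  assumes "0 < \<alpha>" "\<alpha> < 1" "holomorphic_self_map \<phi>"
    and bdd: "bounded_on_dirichlet \<alpha> (weighted_comp \<psi> \<phi>)"
  shows "bdd_above ((\<lambda>z. cmod (\<psi> z) *
           ((1 - (cmod z)\<^sup>2) / (1 - (cmod (\<phi> z))\<^sup>2)) powr (\<alpha> / 2)) ` unit_disc)"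
proof -
  let ?T = "weighted_comp \<psi> \<phi>"
  obtain C where C: "\<And>f. f \<in> dirichlet_space \<alpha> \<Longrightarrow>
      dirichlet_norm \<alpha> (?T f) \<le> C * dirichlet_norm \<alpha> f"
    using bdd by (auto simp: bounded_on_dirichlet_def)
  have T: "?T f \<in> dirichlet_space \<alpha>" if "f \<in> dirichlet_space \<alpha>" for f
    using bdd that by (auto simp: bounded_on_dirichlet_def linear_on_dirichlet_def)
  have "cmod (\<psi> z) * ((1 - (cmod z)\<^sup>2) / (1 - (cmod (\<phi> z))\<^sup>2)) powr (\<alpha> / 2) \<le> C / sqrt \<alpha>"
    if z: "z \<in> unit_disc" for z
  proof -
    have \<phi>z: "\<phi> z \<in> unit_disc"
      using assms(3) z unfolding holomorphic_self_map_def by blast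
    let ?k = "normalized_kernel \<alpha> (\<phi> z)" and ?s = "sqrt (kernel_diagonal \<alpha> ((cmod z)\<^sup>2))"
    have s: "?s > 0"
      using kernel_diagonal_pos[of \<alpha> "(cmod z)\<^sup>2"] cmod_sq_less_1[OF z] assms by simp
    have k: "?k \<in> dirichlet_space \<alpha>" "dirichlet_norm \<alpha> ?k = 1"
      using normalized_kernel_in_dirichlet_space dirichlet_norm_normalized_kernel assms \<phi>z by auto
    have "cmod (?T ?k z) \<le> dirichlet_norm \<alpha> (?T ?k) * ?s"
      using dirichlet_pointwise_bound[OF T[OF k(1)] assms(2) z] .
    also have "\<dots> \<le> C * ?s"
      using C[OF k(1)] k(2) s by (intro mult_right_mono) auto
    finally have "cmod (?T ?k z) / ?s \<le> C"
      using s by (simp add: field_simps)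
    hence "cmod (?T ?k z) / ?s / sqrt \<alpha> \<le> C / sqrt \<alpha>"
      using assms by (intro divide_right_mono) auto
    with weighted_distortion_le_test_value[of \<alpha> z \<phi> \<psi>] assms(1,2) z \<phi>z show ?thesis
      by linarith
  qed
  thus ?thesis by (intro bdd_aboveI2) auto
qed

text \<open>
  Compactness of an operator is stated with sequences, so the failure of a limit at the unit circle
  has to be witnessed by a sequence of points.
\<close>

lemma not_tendsto_at_unit_circle_sequence:
  fixes F :: "complex \<Rightarrow> real"
  assumes "\<not> (F \<longlongrightarrow> 0) (filtercomap cmod (at_left 1))"
  obtains e z where "e > 0" "filterlim z (filtercomap cmod (at_left 1)) sequentially"
    "\<And>n. z n \<in> unit_disc" "\<And>n::nat. \<bar>F (z n)\<bar> \<ge> e"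
proof -
  obtain e where e: "e > 0"
    "\<not> eventually (\<lambda>z. dist (F z) 0 < e) (filtercomap cmod (at_left 1))"
    using assms by (auto simp: tendsto_iff)
  have "\<exists>z. 1 - inverse (real (Suc n)) < cmod z \<and> cmod z < 1 \<and> \<bar>F z\<bar> \<ge> e" for n
  proof (rule ccontr)
    assume *: "\<not> ?thesis"
    have "eventually (\<lambda>r::real. 1 - inverse (real (Suc n)) < r \<and> r < 1) (at_left 1)"
      by (rule eventually_at_leftI[of "1 - inverse (real (Suc n))"]) auto
    hence "eventually (\<lambda>z. dist (F z) 0 < e) (filtercomap cmod (at_left 1))"
      unfolding eventually_filtercomap using * by (intro exI conjI) (assumption, auto)
    with e show False by blast
  qed
  then obtain z where z: "\<And>n. 1 - inverse (real (Suc n)) < cmod (z n)" "\<And>n. cmod (z n) < 1"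
    "\<And>n. \<bar>F (z n)\<bar> \<ge> e"
    by metis
  have "(\<lambda>n. cmod (z n)) \<longlonglongrightarrow> 1"
  proof (rule real_tendsto_sandwich)
    show "(\<lambda>n. 1 - inverse (real (Suc n))) \<longlonglongrightarrow> 1"
      using tendsto_diff[OF tendsto_const LIMSEQ_inverse_real_of_nat, of 1] by simp
  qed (use z in \<open>auto intro!: always_eventually less_imp_le\<close>)
  hence "filterlim (\<lambda>n. cmod (z n)) (at_left 1) sequentially"
    using z(2) by (auto simp: filterlim_at intro!: always_eventually order.strict_implies_not_eq)
  hence "filterlim z (filtercomap cmod (at_left 1)) sequentially"
    by (simp add: filterlim_filtercomap_iff o_def)
  with e(1) z that show thesis by auto
qed

text \<open>
  Norm convergence controls the values at the moving points z_n in units of sqrt (K(\<bar>z_n\<bar>^2)), and in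
  these units the fixed limit function vanishes at the unit circle.
\<close>

lemma compact_imp_weighted_distortion_tendsto_0:
  assumes "0 < \<alpha>" "\<alpha> < 1" "holomorphic_self_map \<phi>"
    and cpt: "compact_on_dirichlet \<alpha> (weighted_comp \<psi> \<phi>)"
  shows "((\<lambda>z. cmod (\<psi> z) *
           ((1 - (cmod z)\<^sup>2) / (1 - (cmod (\<phi> z))\<^sup>2)) powr (\<alpha> / 2)) \<longlongrightarrow> 0)
         (filtercomap cmod (at_left 1))"
proof (rule ccontr)
  let ?T = "weighted_comp \<psi> \<phi>"
  let ?s = "\<lambda>z. sqrt (kernel_diagonal \<alpha> ((cmod z)\<^sup>2))"
  assume "\<not> ?thesis"
  then obtain e z where e: "e > 0"
    and lim: "filterlim z (filtercomap cmod (at_left 1)) sequentially"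
    and z: "\<And>n. z n \<in> unit_disc"
    and ge: "\<And>n::nat. \<bar>cmod (\<psi> (z n)) *
           ((1 - (cmod (z n))\<^sup>2) / (1 - (cmod (\<phi> (z n)))\<^sup>2)) powr (\<alpha> / 2)\<bar> \<ge> e"
    by (rule not_tendsto_at_unit_circle_sequence) blast
  have \<phi>z: "\<phi> (z n) \<in> unit_disc" for n
    using assms(3) z unfolding holomorphic_self_map_def by blast
  define k where "k n = normalized_kernel \<alpha> (\<phi> (z n))" for n
  have k: "k n \<in> dirichlet_space \<alpha>" "dirichlet_norm \<alpha> (k n) = 1" for n
    using normalized_kernel_in_dirichlet_space dirichlet_norm_normalized_kernel assms \<phi>z
    by (auto simp: k_def)
  have "range k \<subseteq> dirichlet_space \<alpha>" "bdd_above (range (\<lambda>n. dirichlet_norm \<alpha> (k n)))"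
    using k by auto
  then obtain g r where g: "g \<in> dirichlet_space \<alpha>" and r: "strict_mono r"
    and conv: "(\<lambda>n. dirichlet_norm \<alpha> (\<lambda>x. ?T (k (r n)) x - g x)) \<longlonglongrightarrow> 0"
    using cpt unfolding compact_on_dirichlet_def by blast
  have lim_r: "filterlim (\<lambda>n. z (r n)) (filtercomap cmod (at_left 1)) sequentially"
    using filterlim_compose[OF lim filterlim_subseq[OF r]] .
  have "(\<lambda>n. (dirichlet_norm \<alpha> (\<lambda>x. ?T (k (r n)) x - g x) +
      cmod (g (z (r n))) / ?s (z (r n))) / sqrt \<alpha>) \<longlonglongrightarrow> (0 + 0) / sqrt \<alpha>"
    using filterlim_compose[OF dirichlet_little_o_at_unit_circle[OF g assms(1,2)] lim_r] assms
    by (intro tendsto_divide tendsto_add conv tendsto_const) auto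
  moreover have "e \<le> (dirichlet_norm \<alpha> (\<lambda>x. ?T (k (r n)) x - g x) +
      cmod (g (z (r n))) / ?s (z (r n))) / sqrt \<alpha>" for n
  proof -
    let ?z = "z (r n)" and ?h = "\<lambda>x. ?T (k (r n)) x - g x"
    have s: "?s ?z > 0"
      using kernel_diagonal_pos[of \<alpha> "(cmod ?z)\<^sup>2"] cmod_sq_less_1[OF z] assms by simp
    have "?T (k (r n)) \<in> dirichlet_space \<alpha>"
      using cpt k(1) by (auto simp: compact_on_dirichlet_def linear_on_dirichlet_def)
    hence "?h \<in> dirichlet_space \<alpha>"
      using g by (rule dirichlet_space_diff)
    hence "cmod (?h ?z) \<le> dirichlet_norm \<alpha> ?h * ?s ?z"
      using dirichlet_pointwise_bound[of ?h \<alpha> ?z] assms z by simp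
    hence "cmod (?T (k (r n)) ?z) \<le> dirichlet_norm \<alpha> ?h * ?s ?z + cmod (g ?z)"
      using norm_triangle_sub[of "?T (k (r n)) ?z" "g ?z"] by linarith
    hence "cmod (?T (k (r n)) ?z) / ?s ?z \<le> dirichlet_norm \<alpha> ?h + cmod (g ?z) / ?s ?z"
      using s by (simp add: field_simps)
    hence "cmod (?T (k (r n)) ?z) / ?s ?z / sqrt \<alpha> \<le>
        (dirichlet_norm \<alpha> ?h + cmod (g ?z) / ?s ?z) / sqrt \<alpha>"
      using assms by (intro divide_right_mono) auto
    moreover have "e \<le> cmod (?T (k (r n)) ?z) / ?s ?z / sqrt \<alpha>"
      using weighted_distortion_le_test_value[of \<alpha> ?z \<phi> \<psi>] assms(1,2) z \<phi>z ge[of "r n"]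
      unfolding k_def by (smt (verit) mult_nonneg_nonneg norm_ge_zero powr_ge_zero)
    ultimately show ?thesis by linarith
  qed
  ultimately have "e \<le> (0 + 0) / sqrt \<alpha>"
    by (intro LIMSEQ_le_const) auto
  with e show False by simp
qed

theorem proposition3p1:
  fixes \<alpha> :: real and \<psi> \<phi> :: "complex \<Rightarrow> complex"
  assumes "\<alpha> \<in> {0<..<1}"
    and "\<psi> holomorphic_on unit_disc"
    and "holomorphic_self_map \<phi>"
  shows "(bounded_on_dirichlet \<alpha> (weighted_comp \<psi> \<phi>) \<longrightarrow>
            bdd_above ((\<lambda>z. cmod (\<psi> z) *
              ((1 - (cmod z)\<^sup>2) / (1 - (cmod (\<phi> z))\<^sup>2)) powr (\<alpha> / 2)) ` unit_disc)) \<and>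
         (compact_on_dirichlet \<alpha> (weighted_comp \<psi> \<phi>) \<longrightarrow>
            ((\<lambda>z. cmod (\<psi> z) *
              ((1 - (cmod z)\<^sup>2) / (1 - (cmod (\<phi> z))\<^sup>2)) powr (\<alpha> / 2)) \<longlongrightarrow> 0)
              (filtercomap cmod (at_left 1)))"
  using bounded_imp_weighted_distortion_bounded[of \<alpha> \<phi> \<psi>]
    compact_imp_weighted_distortion_tendsto_0[of \<alpha> \<phi> \<psi>] assms by simp

end
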